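(* Every group $(G,\cdot)$ is locally embeddable into the class of finite IP loops: for every finite subset $X\subseteq G$ there is a finite IP loop $(H,* )$ with $X\subseteq H$ and $x\cdot y=x*y$ for all $x,y\in X$ with $x\cdot y\in X$. Equivalently, every group embeds into some ultraproduct of finite IP loops.
   Context: An IP loop (loop with the inverse property) is a loop in which every element $x$ has a two-sided inverse $x^{-1}$ and the identities $x^{-1}(xy)=y=(yx)x^{-1}$ hold. *)

theory Defs
  imports "HOL-Algebra.Group"
begin

definition is_loop :: "'a set \<Rightarrow> ('a \<Rightarrow> 'a \<Rightarrow> 'a) \<Rightarrow> 'a \<Rightarrow> bool" where
  "is_loop H lop e \<longleftrightarrow>
     (\<forall>x\<in>H. \<forall>y\<in>H. lop x y \<in> H) \<and> e \<in> H \<and>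
     (\<forall>x\<in>H. lop e x = x \<and> lop x e = x) \<and>
     (\<forall>a\<in>H. \<forall>b\<in>H. (\<exists>!x. x \<in> H \<and> lop a x = b) \<and> (\<exists>!y. y \<in> H \<and> lop y a = b))"

definition is_ip_loop :: "'a set \<Rightarrow> ('a \<Rightarrow> 'a \<Rightarrow> 'a) \<Rightarrow> 'a \<Rightarrow> bool" where
  "is_ip_loop H lop e \<longleftrightarrow> is_loop H lop e \<and>
     (\<forall>x\<in>H. \<exists>x'\<in>H. lop x' x = e \<and> lop x x' = e \<and>
        (\<forall>y\<in>H. lop x' (lop x y) = y \<and> lop (lop y x) x' = y))"

end

theory Submission
  imports Defs "HOL-Library.Numeral_Type"
begin

text \<open>
  An IP loop with inverse map $x \mapsto -x$ is the same as a ternary relation $T$ ($xyz = 1$) that is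
  functional, total, and invariant under $(x,y,z) \mapsto (y,z,x)$ and
  $(x,y,z) \mapsto (-z,-y,-x)$. Close the finite set under inverses and map it by an injection that
  commutes with inversion into a large finite group $K$ (written additively, nilpotent of class 2).
  For every triple $xyz = 1$ of nonidentity elements of the finite set, the images should become a
  triple, although their sum in $K$ is not zero. This is done by a trade that generalises the
  switching of a Pasch configuration in a Steiner triple system: with $p = -(x+y)$, $q = -(y+z)$,
  $r = -(z+x)$, the triples $(x,y,p)$, $(y,z,q)$, $(z,x,r)$ of $K$ are exchanged for $(x,y,z)$,
  $(p,x,r)$, $(q,y,p)$, $(r,z,q)$. The new triples also use up the pairs $(p,q)$, $(q,r)$, $(r,p)$; since
  $w = p+q+r$ is central, these pairs are freed by exchanging, on the cosets $p+S$, $q+S$, $r+S$ of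
  a central subgroup $S$ containing $w$, the triples with sum $0$ for those whose offsets have sum
  $0$, other than $(p,q,r)$ itself. The group $K$ is generic enough for the trades of different triples not to interfere.
\<close>

section \<open>IP loops from ternary relations\<close>

lemma binary_add_self [simp]: "(x::2) + x = 0" "x + (x + y) = y"
proof -
  have "(2::2) = 0" by simp
  then show "x + x = 0" by (metis mult_2 mult_zero_left)
  then show "x + (x + y) = y" by (metis add.assoc add.left_neutral)
qed

lemma binary_uminus [simp]: "- (x::2) = x"
  by (metis binary_add_self(1) minus_unique)

lemma binary_numeral_even [simp]: "(numeral (Num.Bit0 n) :: 2) = 0"
  by (simp only: numeral_Bit0 binary_add_self)

lemma ternary_add_self: "(x::3) + x = - x"
proof -
  have "(3::3) = 0" by simp
  then have "3 * x = 0" by (metis mult_zero_left)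
  then have "x + x + x = 0" by (simp add: algebra_simps)
  then show ?thesis by (metis add_eq_0_iff2)
qed

text \<open>Reversing the triple (x, y, -xy) gives (xy, -y, -x), which reads (xy)y^{-1} = x; a
  rotation of it reads x^{-1}(xy) = y. These two laws invert all translations, which gives unique
  divisibility.\<close>

lemma is_ip_loop_of_triples:
  fixes H :: "'k::group_add set" and T :: "'k \<Rightarrow> 'k \<Rightarrow> 'k \<Rightarrow> bool"
  assumes zero: "0 \<in> H" and uminus: "\<And>x. x \<in> H \<Longrightarrow> - x \<in> H"
    and carrier: "\<And>x y z. T x y z \<Longrightarrow> z \<in> H"
    and total: "\<And>x y. x \<in> H \<Longrightarrow> y \<in> H \<Longrightarrow> \<exists>z. T x y z"
    and functional: "\<And>x y z z'. T x y z \<Longrightarrow> T x y z' \<Longrightarrow> z = z'"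
    and rot: "\<And>x y z. T x y z \<Longrightarrow> T y z x"
    and rev: "\<And>x y z. T x y z \<Longrightarrow> T (- z) (- y) (- x)"
    and unit: "\<And>x. x \<in> H \<Longrightarrow> T 0 x (- x)"
  defines "m \<equiv> \<lambda>x y. - (THE z. T x y z)"
  shows "is_ip_loop H m 0" and "\<And>x y z. T x y z \<Longrightarrow> m x y = - z"
proof -
  show eq: "m x y = - z" if "T x y z" for x y z
    unfolding m_def using the_equality[of "T x y" z] functional that by metis
  have tri: "T x y (- m x y)" if "x \<in> H" "y \<in> H" for x y
    using total[OF that] eq by (metis minus_minus)
  have closed: "m x y \<in> H" if "x \<in> H" "y \<in> H" for x y
    using tri[OF that] carrier uminus by (metis minus_minus)
  have left: "m (- x) (m x y) = y" if "x \<in> H" "y \<in> H" for x y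
  proof -
    have "T (m x y) (- y) (- x)" using rev[OF tri[OF that]] by simp
    from eq[OF rot[OF rot[OF this]]] show ?thesis by simp
  qed
  have right: "m (m y x) (- x) = y" if "x \<in> H" "y \<in> H" for x y
  proof -
    have "T (m y x) (- x) (- y)" using rev[OF tri[OF that(2,1)]] by simp
    from eq[OF this] show ?thesis by simp
  qed
  have unit_left: "m 0 x = x" if "x \<in> H" for x
    using eq[OF unit[OF that]] by simp
  have unit_right: "m x 0 = x" if "x \<in> H" for x
    using eq[OF rot[OF rot[OF unit[OF uminus[OF that]]]]] by simp
  have inv_right: "m x (- x) = 0" if "x \<in> H" for x
    using eq[OF rot[OF unit[OF that]]] by simp
  have inv_left: "m (- x) x = 0" if "x \<in> H" for x
    using inv_right[OF uminus[OF that]] by simp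
  have left': "m x (m (- x) y) = y" if "x \<in> H" "y \<in> H" for x y
    using left[OF uminus[OF that(1)] that(2)] by simp
  have right': "m (m y (- x)) x = y" if "x \<in> H" "y \<in> H" for x y
    using right[OF uminus[OF that(1)] that(2)] by simp
  have "\<exists>!x. x \<in> H \<and> m a x = b" if "a \<in> H" "b \<in> H" for a b
    using left[OF that(1)] left'[OF that] closed[OF uminus[OF that(1)] that(2)] by metis
  moreover have "\<exists>!y. y \<in> H \<and> m y a = b" if "a \<in> H" "b \<in> H" for a b
    using right[OF that(1)] right'[OF that] closed[OF that(2) uminus[OF that(1)]] by metis
  ultimately have "is_loop H m 0"
    unfolding is_loop_def using closed zero unit_left unit_right by simp
  moreover have "\<exists>x'\<in>H. m x' x = 0 \<and> m x x' = 0 \<and> (\<forall>y\<in>H. m x' (m x y) = y \<and> m (m y x) x' = y)"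
    if "x \<in> H" for x
    using that uminus inv_left inv_right left right by (intro bexI[of _ "- x"]) auto
  ultimately show "is_ip_loop H m 0" unfolding is_ip_loop_def by blast
qed

section \<open>Trades\<close>

locale ip_trade =
  fixes H :: "'k::group_add set" and W :: "'k \<Rightarrow> 'k \<Rightarrow> 'k \<Rightarrow> bool"
    and S :: "'k \<Rightarrow> 'k \<Rightarrow> 'k \<Rightarrow> 'k set" and par :: "'k \<Rightarrow> 2"
  assumes H_zero: "0 \<in> H" and H_add: "\<And>a b. a \<in> H \<Longrightarrow> b \<in> H \<Longrightarrow> a + b \<in> H"
    and H_uminus: "\<And>a. a \<in> H \<Longrightarrow> - a \<in> H"
    and W_H: "\<And>x y z. W x y z \<Longrightarrow> x \<in> H"
    and W_rot: "\<And>x y z. W x y z \<Longrightarrow> W y z x"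
    and W_rev: "\<And>x y z. W x y z \<Longrightarrow> W (- z) (- y) (- x)"
    and W_functional: "\<And>x y z z'. W x y z \<Longrightarrow> W x y z' \<Longrightarrow> z = z'"
    and S_H: "\<And>x y z i. W x y z \<Longrightarrow> i \<in> S x y z \<Longrightarrow> i \<in> H"
    and S_zero: "\<And>x y z. W x y z \<Longrightarrow> 0 \<in> S x y z"
    and S_add: "\<And>x y z i j. W x y z \<Longrightarrow> i \<in> S x y z \<Longrightarrow> j \<in> S x y z \<Longrightarrow> i + j \<in> S x y z"
    and S_uminus: "\<And>x y z i. W x y z \<Longrightarrow> i \<in> S x y z \<Longrightarrow> - i \<in> S x y z"
    and S_central: "\<And>x y z i a. W x y z \<Longrightarrow> i \<in> S x y z \<Longrightarrow> i + a = a + i"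
    and S_rot: "\<And>x y z. W x y z \<Longrightarrow> S y z x = S x y z"
    and S_rev: "\<And>x y z. W x y z \<Longrightarrow> S (- z) (- y) (- x) = S x y z"
    and par_add: "\<And>a b. par (a + b) = par a + par b"
    and par_W: "\<And>x y z. W x y z \<Longrightarrow> par x = 1"
    and par_S: "\<And>x y z i. W x y z \<Longrightarrow> i \<in> S x y z \<Longrightarrow> par i = 0"
    and defect_in_S: "\<And>x y z. W x y z \<Longrightarrow> - (x + y) + - (y + z) + - (z + x) \<in> S x y z"
    and add_notin_S: "\<And>x y z. W x y z \<Longrightarrow> x + y \<notin> S x y z"
    and sep: "\<And>x y z x' y' z' i j i' j'. W x y z \<Longrightarrow> W x' y' z' \<Longrightarrow>
        i \<in> S x y z \<Longrightarrow> j \<in> S x y z \<Longrightarrow> i' \<in> S x' y' z' \<Longrightarrow> j' \<in> S x' y' z' \<Longrightarrow>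
        - (x + y) + i = - (x' + y') + i' \<Longrightarrow> - (y + z) + j = - (y' + z') + j' \<Longrightarrow>
        x = x' \<and> y = y' \<and> z = z'"
begin

text \<open>
  The triples introduced by the trade. Since the relation is closed under cyclic shifts, rules N2, N3
  and N4 describe the three rotations of the same kind of triple.
\<close>

inductive N :: "'k \<Rightarrow> 'k \<Rightarrow> 'k \<Rightarrow> bool" where
  N1: "W x y z \<Longrightarrow> N x y z"
| N2: "W x y z \<Longrightarrow> N (- (x + y)) x (- (z + x))"
| N3: "W x y z \<Longrightarrow> N y (- (x + y)) (- (y + z))"
| N4: "W x y z \<Longrightarrow> N (- (x + y)) (- (y + z)) y"
| N5: "W x y z \<Longrightarrow> i \<in> S x y z \<Longrightarrow> j \<in> S x y z \<Longrightarrow> k \<in> S x y z \<Longrightarrow> i + j + k = 0 \<Longrightarrow> i \<noteq> 0 \<or> j \<noteq> 0 \<Longrightarrow>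
    N (- (x + y) + i) (- (y + z) + j) (- (z + x) + k)"

definition dom_N :: "'k \<Rightarrow> 'k \<Rightarrow> bool" where
  "dom_N a b \<longleftrightarrow> (\<exists>c. N a b c)"

lemma W_H': "W x y z \<Longrightarrow> x \<in> H \<and> y \<in> H \<and> z \<in> H"
  using W_H W_rot by blast

lemma par_W': "W x y z \<Longrightarrow> par x = 1 \<and> par y = 1 \<and> par z = 1"
  using par_W W_rot by blast

lemma par_zero: "par 0 = 0"
  using par_add[of 0 0] by simp

lemma par_uminus: "par (- a) = par a"
  using par_add[of a "- a"] par_zero by (simp add: add_eq_0_iff)

lemma dom_N_cases:
  assumes "dom_N a b"
  obtains (1) x y z where "W x y z" "a = x" "b = y"
  | (2) x y z where "W x y z" "a = - (x + y)" "b = x"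
  | (3) x y z where "W x y z" "a = y" "b = - (x + y)"
  | (4) x y z i j where "W x y z" "i \<in> S x y z" "j \<in> S x y z" "a = - (x + y) + i" "b = - (y + z) + j"
proof -
  from assms obtain c where "N a b c" unfolding dom_N_def by blast
  then show ?thesis
  proof cases
    case (N4 x z)
    then show ?thesis using 4[of x c z 0 0] S_zero by simp
  qed (use 1 2 3 4 in auto)
qed

text \<open>In the block (p + S) x (q + S) the pair (p, q) is covered by \<open>N4\<close>, every
  other pair by \<open>N5\<close> with third offset -(i + j).\<close>

lemma dom_N_block:
  assumes "W x y z" "i \<in> S x y z" "j \<in> S x y z"
  shows "dom_N (- (x + y) + i) (- (y + z) + j)"
proof (cases "i = 0 \<and> j = 0")
  case True
  then show ?thesis using N4[OF assms(1)] unfolding dom_N_def by auto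
next
  case False
  then have "N (- (x + y) + i) (- (y + z) + j) (- (z + x) + - (i + j))"
    using assms by (intro N5) (auto intro: S_uminus S_add)
  then show ?thesis unfolding dom_N_def by blast
qed

section \<open>Symmetries of the new triples\<close>

lemma N_rot:
  assumes "N a b c"
  shows "N b c a"
  using assms
proof cases
  case N1
  then show ?thesis using N.N1 W_rot by blast
next
  case (N2 y z)
  then show ?thesis using N.N3[of z b y] W_rot by blast
next
  case (N3 x z)
  then show ?thesis using N.N4[of x a z] by blast
next
  case (N4 x z)
  then show ?thesis using N.N2[of c z x] W_rot by blast
next
  case (N5 x y z i j k)
  have "j + k = - i"
    using N5(8) by (simp add: add.assoc add_eq_0_iff)
  then have "j + k + i = 0" by simp
  moreover have "j \<noteq> 0 \<or> k \<noteq> 0" using N5(8,9) by auto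
  ultimately show ?thesis
    unfolding N5(1-3) using N5(5-7) by (intro N.N5[OF W_rot[OF N5(4)]]) (simp_all only: S_rot[OF N5(4)])
qed

text \<open>The triple (-z, -y, -x) has -q, -p, -r in the roles of p, q, r, so reversal carries the
  new triples of (x, y, z) to those of (-z, -y, -x), up to rotation.\<close>

lemma N_rev:
  assumes "N a b c"
  shows "N (- c) (- b) (- a)"
  using assms
proof cases
  case N1
  then show ?thesis using N.N1 W_rev by blast
next
  case (N2 y z)
  have "N (- b) (- (- y + - b)) (- (- b + - z))" using N.N3[OF W_rot[OF W_rev[OF N2(3)]]] .
  from N_rot[OF N_rot[OF this]] show ?thesis using N2 by (simp add: minus_add)
next
  case (N3 x z)
  have "N (- (- z + - a)) (- (- a + - x)) (- a)" using N.N4[OF W_rev[OF N3(3)]] .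
  then show ?thesis using N3 by (simp add: minus_add)
next
  case (N4 x z)
  have "N (- c) (- (- z + - c)) (- (- c + - x))" using N.N3[OF W_rev[OF N4(3)]] .
  then show ?thesis using N4 by (simp add: minus_add)
next
  case (N5 x y z i j k)
  note W = N5(4) and S = N5(5-7)
  have comm: "i' + a' = a' + i'" if "i' \<in> S x y z" for i' a'
    using S_central[OF W that] .
  \<comment> \<open>Reversal permutes the offsets; centrality of \<open>S\<close> restores the order
    in which their sum is known to vanish.\<close>
  have "- j + - i + - k = - (k + i + j)" by (simp add: minus_add add.assoc)
  also have "k + i + j = i + j + k" using comm[OF S(3)] by (simp add: add.assoc)
  finally have "- j + - i + - k = 0" using N5(8) by simp
  then have "N (- (- z + - y) + - j) (- (- y + - x) + - i) (- (- x + - z) + - k)"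
    using N5 by (intro N.N5[OF W_rev[OF W]]) (auto simp: S_rev[OF W] intro: S_uminus[OF W])
  moreover have "- (- z + - y) + - j = - b" "- (- y + - x) + - i = - a" "- (- x + - z) + - k = - c"
    unfolding N5(1-3) using S[THEN S_uminus[OF W], THEN comm] by (simp_all add: minus_add)
  ultimately show ?thesis using N_rot by simp
qed

lemma N_H:
  assumes "N a b c"
  shows "a \<in> H"
  using assms by cases (auto dest: W_H' S_H intro!: H_add H_uminus)

section \<open>The new triples as a partial operation\<close>

text \<open>\<open>N4\<close> is absorbed into the last case with zero offsets, where the third
  entry is y instead of the point r.\<close>

lemma N_cases_par:
  assumes "N a b c"
  obtains (1) "par a = 1" "par b = 1" "W a b c"
  | (2) x y z where "par a = 0" "par b = 1" "W x y z" "a = - (x + y)" "b = x" "c = - (z + x)"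
  | (3) x y z where "par a = 1" "par b = 0" "W x y z" "a = y" "b = - (x + y)" "c = - (y + z)"
  | (4) x y z i j where "par a = 0" "par b = 0" "W x y z" "i \<in> S x y z" "j \<in> S x y z"
      "a = - (x + y) + i" "b = - (y + z) + j"
      "c = (if i = 0 \<and> j = 0 then y else - (z + x) + - (i + j))"
  using assms
proof cases
  case N1
  then show ?thesis using 1 par_W' by blast
next
  case (N2 y z)
  then show ?thesis using 2[of b y z] par_W'[OF N2(3)] by (simp add: par_uminus par_add)
next
  case (N3 x z)
  then show ?thesis using 3[of x a z] par_W'[OF N3(3)] by (simp add: par_uminus par_add)
next
  case (N4 x z)
  then show ?thesis using 4[of x c z 0 0] par_W'[OF N4(3)] S_zero by (simp add: par_uminus par_add)
next
  case (N5 x y z i j k)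
  have "k = - (i + j)" using N5(8) by (metis minus_unique)
  then have "c = (if i = 0 \<and> j = 0 then y else - (z + x) + - (i + j))" using N5 by auto
  then show ?thesis
    using 4[of x y z i j] N5(1-7) par_W'[OF N5(4)] par_S[OF N5(4)] by (simp add: par_uminus par_add)
qed

text \<open>Parity leaves only two triples of the same kind to compare. The pairs (p, x) and (y, p)
  give back x and y by cancellation, hence z; a pair from two cosets gives back its triple by
  \<open>sep\<close>, and then the offsets.\<close>

lemma N_functional:
  assumes "N a b c" "N a b c'"
  shows "c = c'"
  using assms(1)
proof (cases rule: N_cases_par)
  case 1
  with assms(2) show ?thesis by (cases rule: N_cases_par) (auto intro: W_functional)
next
  case (2 x y z)
  note A = this
  from assms(2) show ?thesis
  proof (cases rule: N_cases_par)
    case (2 x1 y1 z1)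
    have "x + y = x1 + y1" "x = x1" using 2 A by (metis minus_minus)+
    then have "W x y z1" using 2 by simp
    then show ?thesis using 2 A W_functional by blast
  qed (use A in auto)
next
  case (3 x y z)
  note A = this
  from assms(2) show ?thesis
  proof (cases rule: N_cases_par)
    case (3 x1 y1 z1)
    have "x + y = x1 + y1" "y = y1" using 3 A by (metis minus_minus)+
    then have "W x y z1" using 3 by simp
    then show ?thesis using 3 A W_functional by blast
  qed (use A in auto)
next
  case (4 x y z i j)
  note A = this
  from assms(2) show ?thesis
  proof (cases rule: N_cases_par)
    case (4 x1 y1 z1 i1 j1)
    have "x = x1 \<and> y = y1 \<and> z = z1"
      using sep[OF A(3) 4(3) A(4,5) 4(4,5)] 4 A by metis
    moreover from this have "i = i1" "j = j1" using 4 A by auto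
    ultimately show ?thesis using 4 A by simp
  qed (use A in auto)
qed

section \<open>Balance of the trade\<close>

text \<open>The group triples whose leading pair is claimed by a new triple form a rotation-closed
  set, so whole triples are removed. The pairs (x, y), (y, p), (p, x) follow one another, and so do
  the three blocks of cosets.\<close>

lemma dom_N_rot:
  assumes "dom_N a b"
  shows "dom_N b (- (a + b))"
  using assms
proof (cases rule: dom_N_cases)
  case (1 x y z)
  then show ?thesis using N3 unfolding dom_N_def by blast
next
  case (2 x y z)
  then have "- (a + b) = y" by (simp add: minus_add add.assoc)
  then show ?thesis using N1 2 unfolding dom_N_def by blast
next
  case (3 x y z)
  then have "- (a + b) = x" by (simp add: minus_add add.assoc)
  then show ?thesis using N2[of x y z] 3 unfolding dom_N_def by auto
next
  case (4 x y z i j)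
  note W = 4(1)
  define w where "w = - (x + y) + - (y + z) + - (z + x)"
  have w: "w \<in> S x y z" unfolding w_def by (rule defect_in_S[OF W])
  have comm: "i' + a' = a' + i'" if "i' \<in> S x y z" for i' a'
    using S_central[OF W that] .
  \<comment> \<open>The group triple starting with p + i, q + j ends in r + k for this k, because w
    = p + q + r is central; k stays in \<open>S\<close> because w does.\<close>
  define k where "k = - j + - i + - w"
  have k: "k \<in> S x y z" unfolding k_def using S_add[OF W] S_uminus[OF W] w 4 by blast
  have "- (x + y) + - (y + z) = w + (z + x)" unfolding w_def by (simp add: add.assoc)
  moreover have "a + b = - (x + y) + - (y + z) + (i + j)"
    unfolding 4 using comm[OF 4(2), of "- (y + z) + _"] comm[OF 4(2), of "- (y + z)"]
    by (metis add.assoc)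
  ultimately have "- (a + b) = - (w + (z + x) + (i + j))" by simp
  also have "\<dots> = (- j + - i) + - (z + x) + - w" by (simp only: minus_add add.assoc)
  also have "(- j + - i) + - (z + x) = - (z + x) + (- j + - i)"
    using S_add[OF W] S_uminus[OF W] 4 by (intro comm) blast
  also have "\<dots> + - w = - (z + x) + k" unfolding k_def by (simp only: add.assoc)
  finally have "- (a + b) = - (z + x) + k" .
  then show ?thesis
    using dom_N_block[OF W_rot[OF W]] 4 k by (simp add: S_rot[OF W])
qed

lemma dom_N_rev:
  assumes "dom_N a b"
  shows "dom_N (- b) (- a)"
  using assms N_rev N_rot unfolding dom_N_def by blast

text \<open>Leaves the group triples (0, x, -x) in place, so that 0 is the unit of the loop and -x
  the inverse of x.\<close>

lemma not_dom_N_zero: "\<not> dom_N 0 b"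
proof
  assume "dom_N 0 b"
  then show False
  proof (cases rule: dom_N_cases)
    case (1 x y z)
    then show False using par_W par_zero by force
  next
    case (2 x y z)
    then have "x + y = 0" by (metis minus_minus minus_zero)
    then show False using add_notin_S[OF 2(1)] S_zero[OF 2(1)] by simp
  next
    case (3 x y z)
    then show False using par_W' par_zero by force
  next
    case (4 x y z i j)
    then have "x + y = i" by (metis add.inverse_unique minus_minus add_eq_0_iff)
    then show False using add_notin_S[OF 4(1)] 4 by simp
  qed
qed

section \<open>The relation after the trade\<close>

definition T :: "'k \<Rightarrow> 'k \<Rightarrow> 'k \<Rightarrow> bool" where
  "T a b c \<longleftrightarrow> N a b c \<or> \<not> dom_N a b \<and> a \<in> H \<and> b \<in> H \<and> a + b + c = 0"

lemma T_rot:
  assumes "T a b c"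
  shows "T b c a"
proof (cases "N a b c")
  case True
  then show ?thesis using N_rot unfolding T_def by blast
next
  case False
  then have nd: "\<not> dom_N a b" and H: "a \<in> H" "b \<in> H" and "a + b + c = 0"
    using assms unfolding T_def by auto
  then have c: "c = - (a + b)" by (metis minus_unique)
  then have a: "a = - (b + c)" by (simp add: minus_add add.assoc)
  have "\<not> dom_N b c"
  proof
    assume "dom_N b c"
    from dom_N_rot[OF dom_N_rot[OF this]] have "dom_N a (- (c + a))" using a by simp
    moreover have "- (c + a) = b" unfolding c by (simp add: minus_add add.assoc)
    ultimately show False using nd by simp
  qed
  moreover have "b + c + a = 0" using a by simp
  ultimately show ?thesis unfolding T_def using H c H_add H_uminus by blast
qed

lemma T_rev:
  assumes "T a b c"
  shows "T (- c) (- b) (- a)"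
proof (cases "N a b c")
  case True
  then show ?thesis using N_rev unfolding T_def by blast
next
  case False
  then have nd: "\<not> dom_N a b" and H: "a \<in> H" "b \<in> H" and "a + b + c = 0"
    using assms unfolding T_def by auto
  then have c: "c = - (a + b)" by (metis minus_unique)
  have "\<not> dom_N (- b) (- a)" using dom_N_rev nd by force
  then have "T (- b) (- a) (- c)" unfolding T_def c using H H_uminus
    by (metis minus_add minus_minus add.left_inverse)
  then show ?thesis using T_rot by blast
qed

theorem ip_loop_exists:
  "\<exists>m. is_ip_loop H m 0 \<and> (\<forall>x y z. W x y z \<longrightarrow> m x y = - z) \<and> (\<forall>x\<in>H. m x (- x) = 0)"
proof -
  have unit: "T 0 x (- x)" if "x \<in> H" for x
    unfolding T_def using not_dom_N_zero H_zero that by simp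
  have carrier: "c \<in> H" if "T a b c" for a b c
    using T_rot[OF T_rot[OF that]] N_H unfolding T_def by blast
  have total: "\<exists>c. T a b c" if "a \<in> H" "b \<in> H" for a b
    unfolding T_def dom_N_def using that by (metis add.right_inverse)
  have functional: "c = c'" if "T a b c" "T a b c'" for a b c c'
    using that N_functional unfolding T_def dom_N_def by (metis minus_unique)
  note * = is_ip_loop_of_triples[of H T, OF H_zero H_uminus carrier total functional T_rot T_rev unit]
  define m where "m = (\<lambda>x y. - (THE z. T x y z))"
  have "is_ip_loop H m 0" unfolding m_def by (rule *(1))
  moreover have "m x y = - z" if "T x y z" for x y z
    unfolding m_def by (rule *(2)) (use that in auto)
  ultimately show ?thesis
    using T_rot unit N1 unfolding T_def by (metis minus_zero)
qed

end

section \<open>The finite group\<close>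

text \<open>
  A central extension of the $\mathbb{F}_2$-space \<open>base\<close> by \<open>cent\<close>, times a
  power of $\mathbb{Z}/3$. An index stands for a class $\{x, x^{-1}\}$, and its boolean component
  says whether $x$ is an involution; the mask makes the generator at such an index square to zero.
  The ternary part is needed only for elements of order three: without it, $p + S$ would contain $0$
  for the triple $(x,x,x)$.
\<close>

datatype 'i ext = Ext (base: "'i \<times> bool \<Rightarrow> 2") (cent: "('i \<times> bool) \<times> ('i \<times> bool) \<Rightarrow> 2")
  (tern: "'i \<times> bool \<Rightarrow> 3")

definition mask :: "'i \<times> bool \<Rightarrow> 'i \<times> bool \<Rightarrow> 2" where
  "mask a b = (if a = b \<and> snd a then 0 else 1)"

instantiation ext :: (type) group_add
begin

definition zero_ext :: "'a ext" where
  "0 = Ext (\<lambda>_. 0) (\<lambda>_. 0) (\<lambda>_. 0)"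

text \<open>The central part gathers a bilinear cocycle, one coordinate for each ordered pair of
  indices. Bilinearity gives associativity; the coordinates at (a, b) and (b, a) tell the order of
  two distinct generators.\<close>

definition plus_ext :: "'a ext \<Rightarrow> 'a ext \<Rightarrow> 'a ext" where
  "k + l = Ext (\<lambda>a. base k a + base l a)
    (\<lambda>(a, b). cent k (a, b) + cent l (a, b) + mask a b * base k a * base l b)
    (\<lambda>a. tern k a + tern l a)"

text \<open>The base part is its own negative; the extra central term cancels the cocycle of
  \<open>k\<close> with itself.\<close>

definition uminus_ext :: "'a ext \<Rightarrow> 'a ext" where
  "- k = Ext (base k) (\<lambda>(a, b). cent k (a, b) + mask a b * base k a * base k b) (\<lambda>a. - tern k a)"

definition minus_ext :: "'a ext \<Rightarrow> 'a ext \<Rightarrow> 'a ext" where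
  "k - l = k + - (l :: 'a ext)"

instance
proof
  fix k l m :: "'a ext"
  show "k + l + m = k + (l + m)"
    by (auto simp: plus_ext_def fun_eq_iff algebra_simps)
  show "0 + k = k" "k + 0 = k"
    by (cases k; simp add: plus_ext_def zero_ext_def fun_eq_iff)+
  show "- k + k = 0"
    by (auto simp: plus_ext_def zero_ext_def uminus_ext_def fun_eq_iff add.commute add.left_commute)
  show "k + - l = k - l" by (simp add: minus_ext_def)
qed

end

lemma ext_sel [simp]:
  "base (0 :: 'i ext) a = 0" "cent (0 :: 'i ext) c = 0" "tern (0 :: 'i ext) a = 0"
  "base (k + l) a = base k a + base l a"
  "cent (k + l) (a, b) = cent k (a, b) + cent l (a, b) + mask a b * base k a * base l b"
  "tern (k + l) a = tern k a + tern l a"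
  "base (- k) a = base k a"
  "cent (- k) (a, b) = cent k (a, b) + mask a b * base k a * base k b"
  "tern (- k) a = - tern k a"
  by (simp_all add: zero_ext_def plus_ext_def uminus_ext_def)

lemma ext_eqI:
  assumes "\<And>a. base k a = base l a" "\<And>a b. cent k (a, b) = cent l (a, b)" "\<And>a. tern k a = tern l a"
  shows "k = l"
  using assms by (cases k; cases l) (auto simp: fun_eq_iff)

lemma ext_central: "(\<And>a. base k a = 0) \<Longrightarrow> k + l = l + k"
  by (rule ext_eqI) (simp_all add: add.commute)

section \<open>Finite subgroups given by finite sets of indices\<close>

definition supported :: "('i \<times> bool) set \<Rightarrow> 'i ext set" where
  "supported I = {k. (\<forall>a. a \<notin> I \<longrightarrow> base k a = 0 \<and> tern k a = 0) \<and>
    (\<forall>a b. a \<notin> I \<or> b \<notin> I \<longrightarrow> cent k (a, b) = 0)}"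

lemma supported_closed:
  "0 \<in> supported I"
  "k \<in> supported I \<Longrightarrow> l \<in> supported I \<Longrightarrow> k + l \<in> supported I"
  "k \<in> supported I \<Longrightarrow> - k \<in> supported I"
  by (auto simp: supported_def)

lemma finite_supported:
  fixes I :: "('i \<times> bool) set"
  assumes "finite I"
  shows "finite (supported I)"
proof -
  let ?B = "{f :: 'i \<times> bool \<Rightarrow> 2. \<forall>a. (a \<in> I \<longrightarrow> f a \<in> UNIV) \<and> (a \<notin> I \<longrightarrow> f a = 0)}"
  let ?C = "{f :: ('i \<times> bool) \<times> ('i \<times> bool) \<Rightarrow> 2.
    \<forall>a. (a \<in> I \<times> I \<longrightarrow> f a \<in> UNIV) \<and> (a \<notin> I \<times> I \<longrightarrow> f a = 0)}"
  let ?T = "{f :: 'i \<times> bool \<Rightarrow> 3. \<forall>a. (a \<in> I \<longrightarrow> f a \<in> UNIV) \<and> (a \<notin> I \<longrightarrow> f a = 0)}"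
  have "finite ?B" "finite ?C" "finite ?T"
    using assms by (intro finite_set_of_finite_funs; simp)+
  then have "finite ((\<lambda>(v, m, u). Ext v m u) ` (?B \<times> ?C \<times> ?T))" by blast
  moreover have "supported I \<subseteq> (\<lambda>(v, m, u). Ext v m u) ` (?B \<times> ?C \<times> ?T)"
  proof
    fix k assume "k \<in> supported I"
    then have "(base k, cent k, tern k) \<in> ?B \<times> ?C \<times> ?T" by (auto simp: supported_def)
    then show "k \<in> (\<lambda>(v, m, u). Ext v m u) ` (?B \<times> ?C \<times> ?T)" by (rule rev_image_eqI) simp
  qed
  ultimately show ?thesis by (rule finite_subset[rotated])
qed

section \<open>Defect and slack\<close>

definition defect :: "'i ext \<Rightarrow> 'i ext \<Rightarrow> 'i ext \<Rightarrow> 'i ext" where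
  "defect x y z = - (x + y) + - (y + z) + - (z + x)"

text \<open>Doubling kills the base part, so this form shows that the defect is central; its central
  part is the cocycle of z + x + y with itself.\<close>

lemma defect_eq: "defect x y z = - ((z + x + y) + (z + x + y))"
  by (simp only: defect_def minus_add add.assoc)

lemma defect_sel [simp]:
  "base (defect x y z) a = 0"
  "cent (defect x y z) (a, b) =
    mask a b * (base x a + base y a + base z a) * (base x b + base y b + base z b)"
  "tern (defect x y z) a = tern x a + tern y a + tern z a"
proof -
  have "tern (defect x y z) a = - (g + g)" if "g = tern z a + tern x a + tern y a" for g
    unfolding defect_eq that by simp
  from this[OF refl] show "tern (defect x y z) a = tern x a + tern y a + tern z a"
    unfolding ternary_add_self by (simp add: add_ac)
qed (simp_all add: defect_eq algebra_simps)

text \<open>The role of $S$ in the trade. The last condition matters for $(x,x,x)$ only, where it forces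
  a trivial ternary part.\<close>

definition slack :: "('i \<times> bool) set \<Rightarrow> 'i ext \<Rightarrow> 'i ext \<Rightarrow> 'i ext \<Rightarrow> 'i ext set" where
  "slack I x y z = {k \<in> supported I. (\<forall>a. base k a = 0) \<and>
    ((\<forall>a b. cent k (a, b) = 0) \<or> (\<forall>a b. cent k (a, b) = cent (defect x y z) (a, b))) \<and>
    ((\<forall>a. tern (defect x y z) a = 0) \<longrightarrow> (\<forall>a. tern k a = 0))}"

lemma slack_subgroup:
  "0 \<in> slack I x y z"
  "k \<in> slack I x y z \<Longrightarrow> l \<in> slack I x y z \<Longrightarrow> k + l \<in> slack I x y z"
  "k \<in> slack I x y z \<Longrightarrow> - k \<in> slack I x y z"
  by (auto simp: slack_def supported_closed)

lemma slack_rot: "slack I y z x = slack I x y z"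
proof -
  have "\<And>a b. cent (defect y z x) (a, b) = cent (defect x y z) (a, b)"
    and "\<And>a. tern (defect y z x) a = tern (defect x y z) a"
    by (simp_all add: add_ac)
  then show ?thesis unfolding slack_def by presburger
qed

text \<open>The central part of the defect depends only on base parts, which negation fixes, and its
  ternary part merely changes sign.\<close>

lemma slack_rev: "slack I (- z) (- y) (- x) = slack I x y z"
proof -
  have "cent (defect (- z) (- y) (- x)) (a, b) = cent (defect x y z) (a, b)" for a b
    by (simp add: add_ac)
  moreover have "tern (defect (- z) (- y) (- x)) a = 0 \<longleftrightarrow> tern (defect x y z) a = 0" for a
  proof -
    have "tern (defect (- z) (- y) (- x)) a = - tern (defect x y z) a" by simp
    then show ?thesis by (metis neg_equal_0_iff_equal)
  qed
  ultimately show ?thesis unfolding slack_def by presburger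
qed

text \<open>Turns the two alternatives for the central part into one unknown scalar, the form in
  which \<open>sep_indices\<close> compares coordinates.\<close>

lemma slack_cent:
  assumes "k \<in> slack I x y z"
  shows "\<exists>\<epsilon> :: 2. \<forall>a b. cent k (a, b) = \<epsilon> * cent (defect x y z) (a, b)"
proof -
  from assms consider "\<forall>a b. cent k (a, b) = 0" | "\<forall>a b. cent k (a, b) = cent (defect x y z) (a, b)"
    unfolding slack_def by blast
  then show ?thesis
  proof cases
    case 1
    then show ?thesis by (intro exI[of _ 0]) simp
  next
    case 2
    then show ?thesis by (intro exI[of _ 1]) simp
  qed
qed

text \<open>The base parts of k and k' agree, so the correction terms of the two negations agree and
  cancel.\<close>

lemma cent_cancel:
  assumes eq: "- k + i = - k' + i'" and base: "\<And>a. base i a = 0" "\<And>a. base i' a = 0"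
  shows "cent k (a, b) + cent i (a, b) = cent k' (a, b) + cent i' (a, b)"
proof -
  have "base k a = base k' a" for a
    using arg_cong[OF eq, of "\<lambda>k. base k a"] by (simp add: base)
  then show ?thesis
    using arg_cong[OF eq, of "\<lambda>k. cent k (a, b)"] by (simp add: base algebra_simps)
qed

section \<open>Disjointness of the trades\<close>

text \<open>
  Here $a, b, c$ are the indices of $x, y, z$. The base parts determine the indices up to a
  transposition when two of them agree; the off-diagonal central coordinates, which record the order
  of the factors, exclude the transposition, and the diagonal ones determine the signs.
\<close>

lemma sep_indices:
  fixes a b c a' b' c' :: "'i \<times> bool" and m :: "'i \<times> bool \<Rightarrow> 'i \<times> bool \<Rightarrow> 2"
  defines "\<delta> \<equiv> \<lambda>a s. of_bool (s = a) :: 2"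
  defines "v \<equiv> \<lambda>s. \<delta> a s + \<delta> b s + \<delta> c s" and "v' \<equiv> \<lambda>s. \<delta> a' s + \<delta> b' s + \<delta> c' s"
  assumes off_diag: "\<And>s t. s \<noteq> t \<Longrightarrow> m s t = 1"
    and not_cube: "\<not> (a = b \<and> b = c)"
    and base1: "\<And>s. \<delta> a s + \<delta> b s = \<delta> a' s + \<delta> b' s"
    and base2: "\<And>s. \<delta> b s + \<delta> c s = \<delta> b' s + \<delta> c' s"
    and cent1: "\<And>s t. \<sigma> * \<delta> a s * \<delta> a t + \<tau> * \<delta> b s * \<delta> b t + m s t * \<delta> a s * \<delta> b t + \<epsilon> * (m s t * v s * v t)
      = \<sigma>' * \<delta> a' s * \<delta> a' t + \<tau>' * \<delta> b' s * \<delta> b' t + m s t * \<delta> a' s * \<delta> b' t + \<epsilon>' * (m s t * v' s * v' t)"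
    and cent2: "\<And>s t. \<tau> * \<delta> b s * \<delta> b t + \<upsilon> * \<delta> c s * \<delta> c t + m s t * \<delta> b s * \<delta> c t + \<eta> * (m s t * v s * v t)
      = \<tau>' * \<delta> b' s * \<delta> b' t + \<upsilon>' * \<delta> c' s * \<delta> c' t + m s t * \<delta> b' s * \<delta> c' t + \<eta>' * (m s t * v' s * v' t)"
    and same: "a = b \<Longrightarrow> \<sigma> = \<tau>" "b = c \<Longrightarrow> \<tau> = \<upsilon>" "a = c \<Longrightarrow> \<sigma> = \<upsilon>"
      "a' = b' \<Longrightarrow> \<sigma>' = \<tau>'" "b' = c' \<Longrightarrow> \<tau>' = \<upsilon>'" "a' = c' \<Longrightarrow> \<sigma>' = \<upsilon>'"
  shows "a = a' \<and> b = b' \<and> c = c' \<and> (\<sigma> = \<sigma>' \<and> \<tau> = \<tau>' \<or> \<tau> = \<tau>' \<and> \<upsilon> = \<upsilon>' \<or> \<sigma> = \<sigma>' \<and> \<upsilon> = \<upsilon>')"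
proof -
  have xor: "(of_bool p + of_bool q :: 2) = of_bool p' + of_bool q' \<longleftrightarrow> (p \<noteq> q) = (p' \<noteq> q')" for p q p' q'
    by (cases p; cases q; cases p'; cases q') simp_all
  have b1: "(s = a) \<noteq> (s = b) \<longleftrightarrow> (s = a') \<noteq> (s = b')" for s
    using base1[of s] unfolding \<delta>_def xor .
  have b2: "(s = b) \<noteq> (s = c) \<longleftrightarrow> (s = b') \<noteq> (s = c')" for s
    using base2[of s] unfolding \<delta>_def xor .
  note defs = \<delta>_def v_def v'_def
  consider "a \<noteq> b" "b \<noteq> c" "a \<noteq> c" | "a = b" "b \<noteq> c" | "b = c" "a \<noteq> b" | "a = c" "a \<noteq> b"
    using not_cube by blast
  then show ?thesis
  proof cases
    case 1
    have "a' = a \<and> b' = b \<and> c' = c" 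
      using b1[of a] b1[of b] b1[of c] b2[of a] b2[of b] b2[of c] 1 by metis
    \<comment> \<open>At the off-diagonal place (a, b) both cocycles contribute 1, which leaves the
      two scalars; once these agree, the diagonal gives the signs.\<close>
    moreover from this have "\<epsilon> = \<epsilon>'" using cent1[of a b] 1 off_diag by (simp add: defs)
    ultimately show ?thesis using cent1[of a a] cent1[of b b] 1 by (simp add: defs)
  next
    case 2
    \<comment> \<open>When two indices agree, \<open>v\<close> is supported at the remaining one, so
      the terms with unknown scalars vanish at every coordinate inspected in this case and the
      following ones.\<close>
    then have "a' = b'" using b1[of a'] by auto
    with 2 b2[of b] b2[of c] consider "b' = b" "c' = c" | "b' = c" "c' = b" by metis
    then show ?thesis
    proof cases
      case 1
      then show ?thesis using cent2[of b b] 2 \<open>a' = b'\<close> same by (simp add: defs)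
    next
      case 2
      then show ?thesis using cent2[of b c] \<open>b \<noteq> c\<close> \<open>a = b\<close> \<open>a' = b'\<close> off_diag by (simp add: defs)
    qed
  next
    case 3
    then have "b' = c'" using b2[of b'] by auto
    with 3 b1[of a] b1[of b] consider "a' = a" "b' = b" | "a' = b" "b' = a" by metis
    then show ?thesis
    proof cases
      case 1
      then show ?thesis using cent1[of b b] 3 \<open>b' = c'\<close> same by (simp add: defs)
    next
      case 2
      then show ?thesis using cent1[of a b] \<open>a \<noteq> b\<close> \<open>b = c\<close> \<open>b' = c'\<close> off_diag by (simp add: defs)
    qed
  next
    case 4
    with b1[of a] b1[of b] consider "a' = a" "b' = b" | "a' = b" "b' = a" by metis
    then show ?thesis
    proof cases
      case 1
      then have "c' = a" using b2[of a] b2[of c'] 4 by auto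
      then show ?thesis using cent1[of a a] 1 4 same by (simp add: defs)
    next
      case 2
      then have "c' = b" using b2[of b] b2[of c'] 4 by auto
      then show ?thesis using cent1[of a b] 2 \<open>a \<noteq> b\<close> \<open>a = c\<close> off_diag by (simp add: defs)
    qed
  qed
qed

section \<open>Embedding a finite part of a group\<close>

context group
begin

section \<open>Indices, signs and the embedding\<close>

text \<open>The choice depends only on the set {x, x^{-1}}; whether x is the chosen element serves
  as its sign.\<close>

definition rep :: "'a \<Rightarrow> 'a" where
  "rep x = (SOME y. y = x \<or> y = inv x)"

definition idx :: "'a \<Rightarrow> 'a \<times> bool" where
  "idx x = (rep x, x = inv x)"

text \<open>The chosen element of a class goes to a generator and its inverse to the negative of
  that generator, whose diagonal central coordinate comes from the cocycle.\<close>

definition emb :: "'a \<Rightarrow> 'a ext" where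
  "emb x = (if x = \<one> then 0 else Ext (\<lambda>a. of_bool (a = idx x))
     (\<lambda>(a, b). of_bool (x \<noteq> rep x) * of_bool (a = idx x) * of_bool (b = idx x))
     (\<lambda>a. if a = idx x \<and> x \<noteq> inv x then if x = rep x then 1 else - 1 else 0))"

lemma rep_cases: "rep x = x \<or> rep x = inv x"
  unfolding rep_def by (rule someI[of "\<lambda>y. y = x \<or> y = inv x" x]) simp

lemma rep_inv: "x \<in> carrier G \<Longrightarrow> rep (inv x) = rep x"
  unfolding rep_def by (simp add: disj_commute)

lemma idx_inv: "x \<in> carrier G \<Longrightarrow> idx (inv x) = idx x"
  unfolding idx_def by (auto simp: rep_inv)

lemma idx_eqD:
  assumes "idx x = idx y" "x \<in> carrier G" "y \<in> carrier G"
  shows "x = y \<or> x = inv y"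
  using assms rep_cases[of x] rep_cases[of y] unfolding idx_def by (metis inv_inv prod.inject)

lemma idx_rep_eqD:
  assumes "idx x = idx y" "x = rep x \<longleftrightarrow> y = rep y" "x \<in> carrier G" "y \<in> carrier G"
  shows "x = y"
  using assms rep_cases[of x] rep_cases[of y] unfolding idx_def by (metis inv_inv prod.inject)

lemma emb_sel:
  assumes "x \<noteq> \<one>"
  shows "base (emb x) a = of_bool (a = idx x)"
    and "cent (emb x) (a, b) = of_bool (x \<noteq> rep x) * of_bool (a = idx x) * of_bool (b = idx x)"
    and "tern (emb x) a = (if a = idx x \<and> x \<noteq> inv x then if x = rep x then 1 else - 1 else 0)"
  using assms by (simp_all add: emb_def)

lemma emb_inv:
  assumes x: "x \<in> carrier G"
  shows "emb (inv x) = - emb x"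
proof (cases "x = \<one>")
  case True
  then show ?thesis by (simp add: emb_def)
next
  case False
  then have "inv x \<noteq> \<one>" using x by (metis inv_inv inv_one)
  note sel = emb_sel[OF False] emb_sel[OF this] idx_inv[OF x] rep_inv[OF x]
  show ?thesis
  proof (cases "x = inv x")
    case True
    then have "x = rep x" "snd (idx x)" using rep_cases[of x] by (auto simp: idx_def)
    with True show ?thesis by (intro ext_eqI) (auto simp: sel mask_def)
  next
    case noninv: False
    then have "\<not> snd (idx x)" by (simp add: idx_def)
    with noninv show ?thesis
      using rep_cases[of x] x by (intro ext_eqI) (auto simp: sel mask_def)
  qed
qed

lemma emb_inj:
  assumes "emb x = emb y" "x \<in> carrier G" "y \<in> carrier G"
  shows "x = y"
proof (cases "x = \<one> \<or> y = \<one>")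
  case True
  have "emb z \<noteq> 0" if "z \<noteq> \<one>" for z
  proof -
    have "base (emb z) (idx z) = 1" using emb_sel(1)[OF that] by simp
    then show ?thesis by (metis ext_sel(1) zero_neq_one)
  qed
  then show ?thesis using True assms(1) by (metis emb_def)
next
  case False
  then have x: "x \<noteq> \<one>" and y: "y \<noteq> \<one>" by auto
  have "base (emb y) (idx x) = 1" using emb_sel(1)[OF x, of "idx x"] assms(1) by simp
  then have idx: "idx x = idx y" using emb_sel(1)[OF y] by (metis of_bool_eq(1) zero_neq_one)
  have "cent (emb x) (idx x, idx x) = cent (emb y) (idx x, idx x)" using assms(1) by simp
  then have "of_bool (x \<noteq> rep x) = (of_bool (y \<noteq> rep y) :: 2)" using idx by (simp add: emb_sel x y)
  then have "x = rep x \<longleftrightarrow> y = rep y" by (metis of_bool_eq_iff)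
  then show ?thesis using idx_rep_eqD[OF idx] assms by blast
qed

section \<open>Triples with product one\<close>

definition unit_triple :: "'a set \<Rightarrow> 'a \<Rightarrow> 'a \<Rightarrow> 'a \<Rightarrow> bool" where
  "unit_triple A x y z \<longleftrightarrow> {x, y, z} \<subseteq> A - {\<one>} \<and> x \<otimes> y \<otimes> z = \<one>"

context
  fixes A
  assumes A_carrier: "A \<subseteq> carrier G" and A_inv: "\<And>x. x \<in> A \<Longrightarrow> inv x \<in> A"
begin

lemma unit_tripleD:
  assumes "unit_triple A x y z"
  shows "x \<in> carrier G" "y \<in> carrier G" "z \<in> carrier G" "x \<in> A" "y \<in> A" "z \<in> A"
    "x \<noteq> \<one>" "y \<noteq> \<one>" "z \<noteq> \<one>" "z = inv (x \<otimes> y)"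
proof -
  show c: "x \<in> carrier G" "y \<in> carrier G" "z \<in> carrier G" "x \<in> A" "y \<in> A" "z \<in> A"
    "x \<noteq> \<one>" "y \<noteq> \<one>" "z \<noteq> \<one>"
    using assms A_carrier by (auto simp: unit_triple_def)
  have "x \<otimes> y \<otimes> z = \<one>" using assms by (simp add: unit_triple_def)
  then show "z = inv (x \<otimes> y)" using c by (metis inv_equality inv_inv m_closed)
qed

lemma unit_triple_rot:
  assumes "unit_triple A x y z"
  shows "unit_triple A y z x"
proof -
  note D = unit_tripleD[OF assms]
  have "y \<otimes> z \<otimes> x = \<one>" unfolding D(10) using D(1,2) by (simp add: inv_mult_group m_assoc[symmetric])
  with assms show ?thesis by (auto simp: unit_triple_def)
qed

lemma unit_triple_functional: "unit_triple A x y z \<Longrightarrow> unit_triple A x y z' \<Longrightarrow> z = z'"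
  using unit_tripleD(10) by (metis (no_types))

lemma unit_triple_rev:
  assumes "unit_triple A x y z"
  shows "unit_triple A (inv z) (inv y) (inv x)"
proof -
  note D = unit_tripleD[OF assms]
  have "inv z \<otimes> inv y \<otimes> inv x = \<one>" unfolding D(10) using D(1,2) by (simp add: m_assoc)
  moreover have "inv x \<noteq> \<one>" "inv y \<noteq> \<one>" "inv z \<noteq> \<one>" using D by (metis inv_inv inv_one)+
  ultimately show ?thesis using D(4-6) A_inv by (simp add: unit_triple_def)
qed

text \<open>Two mutually inverse entries would force the third to be the identity.\<close>

lemma unit_triple_not_inv:
  assumes "unit_triple A x y z"
  shows "x \<noteq> inv y" "y \<noteq> inv z" "x \<noteq> inv z"
proof -
  have *: "x \<noteq> inv y" if "unit_triple A x y z" for x y z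
    using unit_tripleD[OF that] by (metis l_inv inv_one)
  show "x \<noteq> inv y" "y \<noteq> inv z" using * assms unit_triple_rot by blast+
  show "x \<noteq> inv z"
    using *[OF unit_triple_rot[OF unit_triple_rot[OF assms]]] unit_tripleD[OF assms] by (metis inv_inv)
qed

lemma unit_triple_idx_eq:
  assumes "unit_triple A x y z"
  shows "idx x = idx y \<longleftrightarrow> x = y" "idx y = idx z \<longleftrightarrow> y = z" "idx x = idx z \<longleftrightarrow> x = z"
  using unit_triple_not_inv[OF assms] idx_eqD unit_tripleD[OF assms] by metis+

lemma emb_supported:
  assumes "x \<in> A"
  shows "emb x \<in> supported (idx ` A)"
  using assms by (auto simp: emb_def supported_def)

lemma emb_add_notin_slack:
  assumes "unit_triple A x y z"
  shows "emb x + emb y \<notin> slack (idx ` A) (emb x) (emb y) (emb z)"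
proof
  assume k: "emb x + emb y \<in> slack (idx ` A) (emb x) (emb y) (emb z)"
  note D = unit_tripleD[OF assms]
  note sel = emb_sel[OF D(7)] emb_sel[OF D(8)] emb_sel[OF D(9)]
  let ?i = "idx x"
  have "base (emb x + emb y) ?i = 0" using k unfolding slack_def by blast
  then have "idx x = idx y" by (cases "idx x = idx y") (simp_all add: sel)
  then have y: "y = x" using unit_triple_idx_eq[OF assms] by simp
  then have noninv: "x \<noteq> inv x" using unit_triple_not_inv[OF assms] by simp
  then have mask: "mask ?i ?i = 1" by (simp add: mask_def idx_def)
  \<comment> \<open>A nonzero central coordinate must come from the defect; for x = y this
    coordinate of the defect is nonzero only if z has the same index.\<close>
  have "cent (emb x + emb y) (?i, ?i) = 1" by (simp add: y sel mask)
  then have "cent (defect (emb x) (emb y) (emb z)) (?i, ?i) = 1"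
    using k unfolding slack_def by (smt (verit) mem_Collect_eq zero_neq_one)
  then have "idx x = idx z" by (cases "idx x = idx z") (simp_all add: y sel mask)
  then have z: "z = x" using unit_triple_idx_eq[OF assms] by simp
  \<comment> \<open>For (x, x, x) the ternary defect is a triple multiple, hence 0, while 2x keeps a
    nonzero ternary part.\<close>
  have "tern (defect (emb x) (emb y) (emb z)) a = 0" for a
    using ternary_add_self[of "tern (emb x) a"] by (simp add: y z del: mult_2)
  then have "tern (emb x + emb y) ?i = 0" using k unfolding slack_def by blast
  then show False using noninv by (auto simp: y sel split: if_splits)
qed

lemma emb_sep:
  assumes t: "unit_triple A x y z" and t': "unit_triple A x' y' z'"
    and i: "i \<in> slack (idx ` A) (emb x) (emb y) (emb z)" and j: "j \<in> slack (idx ` A) (emb x) (emb y) (emb z)"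
    and i': "i' \<in> slack (idx ` A) (emb x') (emb y') (emb z')"
    and j': "j' \<in> slack (idx ` A) (emb x') (emb y') (emb z')"
    and p: "- (emb x + emb y) + i = - (emb x' + emb y') + i'"
    and q: "- (emb y + emb z) + j = - (emb y' + emb z') + j'"
  shows "x = x' \<and> y = y' \<and> z = z'"
proof -
  note D = unit_tripleD[OF t] and D' = unit_tripleD[OF t']
  note sel = emb_sel[OF D(7)] emb_sel[OF D(8)] emb_sel[OF D(9)]
    emb_sel[OF D'(7)] emb_sel[OF D'(8)] emb_sel[OF D'(9)]
  have base0: "base i s = 0" "base j s = 0" "base i' s = 0" "base j' s = 0" for s
    using i j i' j' unfolding slack_def by blast+
  have base1: "of_bool (s = idx x) + of_bool (s = idx y) = (of_bool (s = idx x') + of_bool (s = idx y') :: 2)" for s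
    using arg_cong[OF p, of "\<lambda>k. base k s"] by (simp add: base0 sel)
  have base2: "of_bool (s = idx y) + of_bool (s = idx z) = (of_bool (s = idx y') + of_bool (s = idx z') :: 2)" for s
    using arg_cong[OF q, of "\<lambda>k. base k s"] by (simp add: base0 sel)
  show ?thesis
  proof (cases "idx x = idx y \<and> idx y = idx z")
    case True
    \<comment> \<open>For (x, x, x) the base parts of p and q vanish, so x is recovered from the
      ternary part, which the slack cannot change here.\<close>
    then have eq: "y = x" "z = x" using unit_triple_idx_eq[OF t] by auto
    have "idx x' = idx y'" using base1[of "idx x'"] by (cases "idx x' = idx y'") (simp_all add: eq)
    moreover have "idx y' = idx z'" using base2[of "idx y'"] by (cases "idx y' = idx z'") (simp_all add: eq)
    ultimately have eq': "y' = x'" "z' = x'" using unit_triple_idx_eq[OF t'] by auto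
    have triple: "u + u + u = 0" for u :: 3
      using ternary_add_self[of u] by simp
    have "tern (defect (emb x) (emb y) (emb z)) s = 0" "tern (defect (emb x') (emb y') (emb z')) s = 0" for s
      unfolding defect_sel eq eq' by (rule triple)+
    then have tern0: "tern i s = 0" "tern i' s = 0" for s
      using i i' unfolding slack_def by blast+
    have tern: "tern (emb x) s = tern (emb x') s" for s
      using arg_cong[OF p, of "\<lambda>k. tern k s"]
      unfolding eq eq' ext_sel tern0 ternary_add_self by simp
    have noninv: "x \<noteq> inv x" using unit_triple_not_inv[OF t] eq by simp
    have "1 \<noteq> (- 1 :: 3)" using ternary_add_self[of 1] by (metis add_cancel_right_right zero_neq_one)
    then have "idx x = idx x' \<and> (x = rep x \<longleftrightarrow> x' = rep x')"
      using tern[of "idx x"] noninv by (auto simp: sel split: if_splits)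
    then show ?thesis using idx_rep_eqD D D' eq eq' by blast
  next
    case False
    obtain \<epsilon> where \<epsilon>: "\<And>s t. cent i (s, t) = \<epsilon> * cent (defect (emb x) (emb y) (emb z)) (s, t)"
      using slack_cent[OF i] by blast
    obtain \<eta> where \<eta>: "\<And>s t. cent j (s, t) = \<eta> * cent (defect (emb x) (emb y) (emb z)) (s, t)"
      using slack_cent[OF j] by blast
    obtain \<epsilon>' where \<epsilon>': "\<And>s t. cent i' (s, t) = \<epsilon>' * cent (defect (emb x') (emb y') (emb z')) (s, t)"
      using slack_cent[OF i'] by blast
    obtain \<eta>' where \<eta>': "\<And>s t. cent j' (s, t) = \<eta>' * cent (defect (emb x') (emb y') (emb z')) (s, t)"
      using slack_cent[OF j'] by blast
    let ?s = "\<lambda>x. of_bool (x \<noteq> rep x) :: 2"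
    have "idx x = idx x' \<and> idx y = idx y' \<and> idx z = idx z' \<and>
      (?s x = ?s x' \<and> ?s y = ?s y' \<or> ?s y = ?s y' \<and> ?s z = ?s z' \<or> ?s x = ?s x' \<and> ?s z = ?s z')"
    proof (rule sep_indices[where m = mask and \<epsilon> = \<epsilon> and \<epsilon>' = \<epsilon>' and \<eta> = \<eta> and \<eta>' = \<eta>', OF _ False base1 base2])
      fix s t
      have "cent (emb x + emb y) (s, t) + cent i (s, t) = cent (emb x' + emb y') (s, t) + cent i' (s, t)"
        using cent_cancel[OF p base0(1,3)] .
      then show "?s x * of_bool (s = idx x) * of_bool (t = idx x) + ?s y * of_bool (s = idx y) * of_bool (t = idx y)
          + mask s t * of_bool (s = idx x) * of_bool (t = idx y)
          + \<epsilon> * (mask s t * (of_bool (s = idx x) + of_bool (s = idx y) + of_bool (s = idx z))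
            * (of_bool (t = idx x) + of_bool (t = idx y) + of_bool (t = idx z)))
        = ?s x' * of_bool (s = idx x') * of_bool (t = idx x') + ?s y' * of_bool (s = idx y') * of_bool (t = idx y')
          + mask s t * of_bool (s = idx x') * of_bool (t = idx y')
          + \<epsilon>' * (mask s t * (of_bool (s = idx x') + of_bool (s = idx y') + of_bool (s = idx z'))
            * (of_bool (t = idx x') + of_bool (t = idx y') + of_bool (t = idx z')))"
        by (simp only: \<epsilon> \<epsilon>' sel ext_sel defect_sel)
      have "cent (emb y + emb z) (s, t) + cent j (s, t) = cent (emb y' + emb z') (s, t) + cent j' (s, t)"
        using cent_cancel[OF q base0(2,4)] .
      then show "?s y * of_bool (s = idx y) * of_bool (t = idx y) + ?s z * of_bool (s = idx z) * of_bool (t = idx z)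
          + mask s t * of_bool (s = idx y) * of_bool (t = idx z)
          + \<eta> * (mask s t * (of_bool (s = idx x) + of_bool (s = idx y) + of_bool (s = idx z))
            * (of_bool (t = idx x) + of_bool (t = idx y) + of_bool (t = idx z)))
        = ?s y' * of_bool (s = idx y') * of_bool (t = idx y') + ?s z' * of_bool (s = idx z') * of_bool (t = idx z')
          + mask s t * of_bool (s = idx y') * of_bool (t = idx z')
          + \<eta>' * (mask s t * (of_bool (s = idx x') + of_bool (s = idx y') + of_bool (s = idx z'))
            * (of_bool (t = idx x') + of_bool (t = idx y') + of_bool (t = idx z')))"
        by (simp only: \<eta> \<eta>' sel ext_sel defect_sel)
    qed (simp_all add: mask_def unit_triple_idx_eq[OF t] unit_triple_idx_eq[OF t'])
    \<comment> \<open>Index and sign determine an element. Signs are known to agree at two places;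
      two entries of a unit triple determine the third.\<close>
    then have "x = x' \<and> y = y' \<or> y = y' \<and> z = z' \<or> x = x' \<and> z = z'"
      using idx_rep_eqD[OF _ _ D(1) D'(1)] idx_rep_eqD[OF _ _ D(2) D'(2)] idx_rep_eqD[OF _ _ D(3) D'(3)]
      by (simp only: of_bool_eq_iff not_iff simp_thms) blast
    then show ?thesis
    proof (elim disjE conjE)
      assume "x = x'" "y = y'"
      with t t' show ?thesis using unit_triple_functional by blast
    next
      assume "y = y'" "z = z'"
      with t t' show ?thesis using unit_triple_functional unit_triple_rot by blast
    next
      assume "x = x'" "z = z'"
      with t t' show ?thesis using unit_triple_functional unit_triple_rot by blast
    qed
  qed
qed

section \<open>The loop containing a finite part of the group\<close>

theorem partial_embedding:
  assumes "finite A"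
  shows "\<exists>m. is_ip_loop (supported (idx ` A)) m 0 \<and>
    (\<forall>x\<in>A. \<forall>y\<in>A. x \<otimes> y \<in> A \<longrightarrow> emb (x \<otimes> y) = m (emb x) (emb y))"
proof -
  let ?H = "supported (idx ` A)"
  let ?W = "\<lambda>X Y Z. \<exists>x y z. unit_triple A x y z \<and> X = emb x \<and> Y = emb y \<and> Z = emb z"
  \<comment> \<open>Parity is the sum of the base coordinates: an embedded nonidentity element has
    exactly one equal to 1, an element of the slack none.\<close>
  interpret ip_trade ?H ?W "slack (idx ` A)" "\<lambda>k. \<Sum>a\<in>idx ` A. base k a"
  proof
    fix X Y Z assume "?W X Y Z"
    then obtain x y z where t: "unit_triple A x y z" and XYZ: "X = emb x" "Y = emb y" "Z = emb z"
      by blast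
    note D = unit_tripleD[OF t]
    show "X \<in> ?H" using emb_supported D XYZ by blast
    show "slack (idx ` A) Y Z X = slack (idx ` A) X Y Z" by (rule slack_rot)
    show "slack (idx ` A) (- Z) (- Y) (- X) = slack (idx ` A) X Y Z" by (rule slack_rev)
    show "?W Y Z X" using unit_triple_rot[OF t] XYZ by blast
    have "- Z = emb (inv z)" "- Y = emb (inv y)" "- X = emb (inv x)" using emb_inv D XYZ by auto
    then show "?W (- Z) (- Y) (- X)" using unit_triple_rev[OF t] by blast
    show "(\<Sum>a\<in>idx ` A. base X a) = 1"
      using assms D by (simp add: XYZ emb_sel(1) of_bool_def)
    show "X + Y \<notin> slack (idx ` A) X Y Z" using emb_add_notin_slack[OF t] XYZ by blast
    show "- (X + Y) + - (Y + Z) + - (Z + X) \<in> slack (idx ` A) X Y Z"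
    proof -
      have "X \<in> ?H" "Y \<in> ?H" "Z \<in> ?H" using emb_supported D XYZ by blast+
      then have "defect X Y Z \<in> ?H" unfolding defect_def by (intro supported_closed)
      then have "defect X Y Z \<in> slack (idx ` A) X Y Z" by (simp add: slack_def)
      then show ?thesis unfolding defect_def .
    qed
  next
    fix X Y Z Z' assume "?W X Y Z" "?W X Y Z'"
    then show "Z = Z'" using emb_inj unit_tripleD(1,2,10) by metis
  next
    fix X Y Z X' Y' Z' i j i' j'
    assume "?W X Y Z" "?W X' Y' Z'"
    then obtain x y z x' y' z' where "unit_triple A x y z" "X = emb x" "Y = emb y" "Z = emb z"
      "unit_triple A x' y' z'" "X' = emb x'" "Y' = emb y'" "Z' = emb z'" by blast
    moreover assume "i \<in> slack (idx ` A) X Y Z" "j \<in> slack (idx ` A) X Y Z"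
      "i' \<in> slack (idx ` A) X' Y' Z'" "j' \<in> slack (idx ` A) X' Y' Z'"
      "- (X + Y) + i = - (X' + Y') + i'" "- (Y + Z) + j = - (Y' + Z') + j'"
    ultimately show "X = X' \<and> Y = Y' \<and> Z = Z'" using emb_sep by blast
  next
    show "(\<Sum>a\<in>idx ` A. base (k + l) a) = (\<Sum>a\<in>idx ` A. base k a) + (\<Sum>a\<in>idx ` A. base l a)" for k l
      by (simp add: sum.distrib)
  next
    fix X Y Z i a assume "i \<in> slack (idx ` A) X Y Z"
    then have base0: "base i b = 0" for b unfolding slack_def by blast
    then show "i + a = a + i" by (rule ext_central)
    show "(\<Sum>a\<in>idx ` A. base i a) = 0" by (simp add: base0)
    show "i \<in> ?H" using \<open>i \<in> slack (idx ` A) X Y Z\<close> unfolding slack_def by blast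
  qed (simp_all add: supported_closed slack_subgroup)
  obtain m where m: "is_ip_loop ?H m 0" "\<And>X Y Z. ?W X Y Z \<Longrightarrow> m X Y = - Z"
    "\<And>X. X \<in> ?H \<Longrightarrow> m X (- X) = 0"
    using ip_loop_exists by blast
  have "emb (x \<otimes> y) = m (emb x) (emb y)" if xy: "x \<in> A" "y \<in> A" "x \<otimes> y \<in> A" for x y
  proof -
    have c: "x \<in> carrier G" "y \<in> carrier G" using xy A_carrier by auto
    have emb_one: "emb \<one> = 0" by (simp add: emb_def)
    have unit: "m 0 X = X" "m X 0 = X" if "X \<in> ?H" for X
      using m(1) that by (simp_all add: is_ip_loop_def is_loop_def)
    \<comment> \<open>Unit triples exclude the identity, so products with it use the unit law and
      products equal to it use the preserved inverses.\<close>
    consider "x = \<one> \<or> y = \<one>" | "x \<otimes> y = \<one>" | "x \<noteq> \<one>" "y \<noteq> \<one>" "x \<otimes> y \<noteq> \<one>" by blast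
    then show ?thesis
    proof cases
      case 1
      then show ?thesis using c unit emb_supported xy by (auto simp: emb_one)
    next
      case 2
      then have "y = inv x" using c by (metis inv_equality inv_inv)
      then show ?thesis using 2 m(3) emb_supported[OF xy(1)] emb_inv[OF c(1)] by (simp add: emb_one)
    next
      case 3
      have "inv (x \<otimes> y) \<noteq> \<one>" using 3 c by (metis inv_inv inv_one m_closed)
      then have "unit_triple A x y (inv (x \<otimes> y))"
        using 3 c xy A_inv unfolding unit_triple_def by auto
      then have "m (emb x) (emb y) = - emb (inv (x \<otimes> y))" using m(2) by blast
      then show ?thesis using emb_inv[of "x \<otimes> y"] c by simp
    qed
  qed
  with m(1) show ?thesis by blast
qed

end

end

section \<open>Transport to the natural numbers\<close>

lemma Ex1_iff_singleton: "(\<exists>!u. u \<in> B \<and> Q u) \<longleftrightarrow> (\<exists>v. {u \<in> B. Q u} = {v})"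
  unfolding Ex1_def set_eq_iff mem_Collect_eq singleton_iff by metis

text \<open>Moves the loop along a numbering of its finite carrier.\<close>

lemma is_ip_loop_image:
  assumes h: "inj_on h H" and loop: "is_ip_loop H m e"
  defines "g \<equiv> inv_into H h"
  shows "is_ip_loop (h ` H) (\<lambda>a b. h (m (g a) (g b))) (h e)"
proof -
  have g: "g (h x) = x" if "x \<in> H" for x
    unfolding g_def using h that by (rule inv_into_f_f)
  have closed: "m x y \<in> H" if "x \<in> H" "y \<in> H" for x y
    using loop that by (simp add: is_ip_loop_def is_loop_def)
  have e: "e \<in> H" using loop by (simp add: is_ip_loop_def is_loop_def)
  have unit: "m e x = x" "m x e = x" if "x \<in> H" for x
    using loop that by (simp_all add: is_ip_loop_def is_loop_def)
  \<comment> \<open>Unique existence is read as a solution set being a singleton, a property that an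
    injective image preserves and reflects.\<close>
  have transfer: "(\<exists>!u. u \<in> h ` H \<and> P (g u)) \<longleftrightarrow> (\<exists>!x. x \<in> H \<and> P x)" for P
  proof -
    have "(\<exists>!u. u \<in> h ` H \<and> P (g u)) \<longleftrightarrow> (\<exists>v. {u \<in> h ` H. P (g u)} = {v})"
      by (rule Ex1_iff_singleton)
    also have "{u \<in> h ` H. P (g u)} = h ` {x \<in> H. P x}" by (auto simp: g)
    also have "(\<exists>u. h ` {x \<in> H. P x} = {u}) \<longleftrightarrow> (\<exists>x. {x \<in> H. P x} = {x})"
    proof
      assume "\<exists>u. h ` {x \<in> H. P x} = {u}"
      then obtain u where u: "h ` {x \<in> H. P x} = {u}" by blast
      then obtain x where x: "x \<in> H" "P x" "h x = u" by blast
      have "y = x" if "y \<in> H" "P y" for y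
        using inj_onD[OF h, of y x] u x that by blast
      then show "\<exists>x. {x \<in> H. P x} = {x}" using x by blast
    qed auto
    also have "\<dots> \<longleftrightarrow> (\<exists>!x. x \<in> H \<and> P x)" by (rule Ex1_iff_singleton[symmetric])
    finally show ?thesis .
  qed
  have eq: "h x = h y \<longleftrightarrow> x = y" if "x \<in> H" "y \<in> H" for x y
    using h that by (auto dest: inj_onD)
  have "is_loop (h ` H) (\<lambda>a b. h (m (g a) (g b))) (h e)"
    unfolding is_loop_def
  proof (intro conjI)
    show "\<forall>u\<in>h ` H. \<forall>v\<in>h ` H. (\<exists>!x. x \<in> h ` H \<and> h (m (g u) (g x)) = v) \<and>
        (\<exists>!y. y \<in> h ` H \<and> h (m (g y) (g u)) = v)"
    proof (intro ballI)
      fix u v assume "u \<in> h ` H" "v \<in> h ` H"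
      then obtain a b where ab: "a \<in> H" "b \<in> H" and uv: "u = h a" "v = h b" by blast
      have "(\<exists>!x. x \<in> H \<and> m a x = b) \<and> (\<exists>!y. y \<in> H \<and> m y a = b)"
        using loop ab by (simp add: is_ip_loop_def is_loop_def)
      moreover have "x \<in> H \<and> h (m (g u) x) = v \<longleftrightarrow> x \<in> H \<and> m a x = b"
        and "x \<in> H \<and> h (m x (g u)) = v \<longleftrightarrow> x \<in> H \<and> m x a = b" for x
        using ab by (auto simp: uv g closed eq)
      ultimately show "(\<exists>!x. x \<in> h ` H \<and> h (m (g u) (g x)) = v) \<and>
          (\<exists>!y. y \<in> h ` H \<and> h (m (g y) (g u)) = v)"
        unfolding transfer[of "\<lambda>x. h (m (g u) x) = v"] transfer[of "\<lambda>x. h (m x (g u)) = v"]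
        by (simp only:)
    qed
  qed (auto simp: g e closed unit)
  moreover have "\<forall>x\<in>h ` H. \<exists>x'\<in>h ` H. h (m (g x') (g x)) = h e \<and> h (m (g x) (g x')) = h e \<and>
      (\<forall>y\<in>h ` H. h (m (g x') (g (h (m (g x) (g y))))) = y \<and> h (m (g (h (m (g y) (g x)))) (g x')) = y)"
  proof
    fix u assume "u \<in> h ` H"
    then obtain x where x: "x \<in> H" "u = h x" by blast
    then obtain x' where x': "x' \<in> H" "m x' x = e" "m x x' = e"
      "\<forall>y\<in>H. m x' (m x y) = y \<and> m (m y x) x' = y"
      using loop unfolding is_ip_loop_def by blast
    show "\<exists>x'\<in>h ` H. h (m (g x') (g u)) = h e \<and> h (m (g u) (g x')) = h e \<and>
      (\<forall>y\<in>h ` H. h (m (g x') (g (h (m (g u) (g y))))) = y \<and> h (m (g (h (m (g y) (g u)))) (g x')) = y)"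
      using x x' closed by (intro bexI[of _ "h x'"]) (auto simp: g)
  qed
  ultimately show ?thesis unfolding is_ip_loop_def by blast
qed

theorem theorem2:
  fixes G (structure) and X :: "'a set"
  assumes "group G" and "finite X" and "X \<subseteq> carrier G"
  shows "\<exists>(H :: nat set) lop e f. finite H \<and> is_ip_loop H lop e \<and>
           inj_on f X \<and> f ` X \<subseteq> H \<and>
           (\<forall>x\<in>X. \<forall>y\<in>X. x \<otimes> y \<in> X \<longrightarrow> f (x \<otimes> y) = lop (f x) (f y))"
proof -
  interpret group G by fact
  define A where "A = X \<union> (\<lambda>x. inv x) ` X"
  have A: "A \<subseteq> carrier G" "\<And>x. x \<in> A \<Longrightarrow> inv x \<in> A" and finA: "finite A" and XA: "X \<subseteq> A"
    using assms(2,3) by (auto simp: A_def)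
  let ?H = "supported (idx ` A)"
  obtain m where m: "is_ip_loop ?H m 0"
    "\<And>x y. x \<in> A \<Longrightarrow> y \<in> A \<Longrightarrow> x \<otimes> y \<in> A \<Longrightarrow> emb (x \<otimes> y) = m (emb x) (emb y)"
    using partial_embedding[OF A finA] by blast
  have finH: "finite ?H" using finA by (intro finite_supported) simp
  then obtain h :: "'a ext \<Rightarrow> nat" where h: "inj_on h ?H"
    using finite_imp_inj_to_nat_seg by blast
  let ?g = "inv_into ?H h"
  have sup: "emb x \<in> ?H" if "x \<in> X" for x
    using that XA emb_supported[OF A] by blast
  have "inj_on (\<lambda>x. h (emb x)) X"
    using h sup emb_inj assms(3) by (intro inj_onI) (metis inj_onD subsetD)
  moreover have "h (emb (x \<otimes> y)) = h (m (?g (h (emb x))) (?g (h (emb y))))"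
    if "x \<in> X" "y \<in> X" "x \<otimes> y \<in> X" for x y
    using m(2)[of x y] that XA sup h by (simp add: inv_into_f_f subset_iff)
  ultimately show ?thesis
    using finH is_ip_loop_image[OF h m(1)] sup
    by (intro exI[of _ "h ` ?H"] exI[of _ "\<lambda>a b. h (m (?g a) (?g b))"] exI[of _ "h 0"]
      exI[of _ "\<lambda>x. h (emb x)"]) auto
qed

end
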